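(* Let $R$ be a commutative unital ring, $n\ge 1$, $A=\Lambda[x_1,\ldots,x_n]$ the exterior algebra over $R$ on $n$ generators, and $A^e=A\otimes_R A^{\mathrm{op}}$. Then the $A^e$-module $A$ admits a resolution $\mathring{B}_\ast$ in which, for every $k\ge 0$, $\mathring{B}_k$ is the free $A^e$-module on the symbols $x_{(\tau)}$, where $\tau$ ranges over all $k$-element multisubsets of $[n]=\{1,\ldots,n\}$, and the boundary is given by $$\mathring{b}_k(x_{(\tau)})=\sum_{i\in\overline{\tau}}\big(x_i\otimes 1+(-1)^k\,1\otimes x_i\big)\,x_{(\tau\setminus\{i\})}.$$
   Context: $A$ is the free $R$-module with basis $x_\sigma=\bigwedge_{i\in\sigma}x_i$ (factors in increasing order), $\sigma\subseteq[n]$, with $x_i^2=0$ and $x_ix_j=-x_jx_i$. $A$ is an $A^e$-module (equivalently an $A$-$A$-bimodule) via $(\alpha\otimes\beta)\cdot a=\alpha a\beta$; the tensor product $A\otimes_R A^{\mathrm{op}}$ is the ordinary (ungraded) one. A $k$-element multisubset $\tau$ of $[n]$ is an increasing sequence $i_1\le\cdots\le i_k$ of elements of $[n]$ (repetitions allowed, $k$ counted with multiplicity). $\overline{\tau}\subseteq[n]$ denotes its underlying set (e.g. $\tau=\{1,1,2,5,5,5\}$ gives $\overline{\tau}=\{1,2,5\}$), and $\tau\setminus\{i\}$ is $\tau$ with one copy of $i$ removed. The augmentation $\mathring{B}_0=A^e\,x_{(\emptyset)}\to A$ of the resolution is the multiplication map $(\alpha\otimes\beta)x_{(\emptyset)}\mapsto\alpha\beta$.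 *)

theory Defs
  imports "HOL-Library.Poly_Mapping" "HOL-Library.Multiset"
begin

(* Conventions. The index set [n] = {1,...,n}, n >= 1, is a type 'n :: {finite, linorder}, i.e. an
   arbitrary nonempty finite linear order. The base ring is a type 'r :: {comm_ring, comm_monoid_mult},
   i.e. an arbitrary commutative unital ring; unlike comm_ring_1, this sort includes the zero ring.
   Likewise {ring, monoid_mult} is the sort of arbitrary unital rings. *)

section \<open>Modules and resolutions over a unital, not necessarily commutative, ring\<close>

locale left_module =
  fixes smult :: "'e::{ring, monoid_mult} \<Rightarrow> 'm::ab_group_add \<Rightarrow> 'm" and M :: "'m set"
  assumes zero_closed: "0 \<in> M"
    and add_closed: "x \<in> M \<Longrightarrow> y \<in> M \<Longrightarrow> x + y \<in> M"
    and uminus_closed: "x \<in> M \<Longrightarrow> - x \<in> M"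
    and smult_closed: "x \<in> M \<Longrightarrow> smult a x \<in> M"
    and smult_add_right: "x \<in> M \<Longrightarrow> y \<in> M \<Longrightarrow> smult a (x + y) = smult a x + smult a y"
    and smult_add_left: "x \<in> M \<Longrightarrow> smult (a + b) x = smult a x + smult b x"
    and smult_smult: "x \<in> M \<Longrightarrow> smult (a * b) x = smult a (smult b x)"
    and smult_one: "x \<in> M \<Longrightarrow> smult 1 x = x"

definition module_hom_on ::
  "('e \<Rightarrow> 'm \<Rightarrow> 'm::ab_group_add) \<Rightarrow> 'm set \<Rightarrow> ('e \<Rightarrow> 'k \<Rightarrow> 'k::ab_group_add) \<Rightarrow> 'k set \<Rightarrow> ('m \<Rightarrow> 'k) \<Rightarrow> bool"
  where "module_hom_on s M t N f \<longleftrightarrow>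
    (\<forall>x\<in>M. f x \<in> N) \<and>
    (\<forall>x\<in>M. \<forall>y\<in>M. f (x + y) = f x + f y) \<and>
    (\<forall>a. \<forall>x\<in>M. f (s a x) = t a (f x))"

(* ... --> B 2 --> B 1 --> B 0 --> M --> 0 is an exact sequence of left modules, with differentials
   d k : B k --> B (k - 1) for k >= 1 and augmentation eps. *)
definition is_resolution ::
  "('e::{ring, monoid_mult} \<Rightarrow> 'm \<Rightarrow> 'm::ab_group_add) \<Rightarrow> (nat \<Rightarrow> 'm set) \<Rightarrow> (nat \<Rightarrow> 'm \<Rightarrow> 'm) \<Rightarrow>
   ('e \<Rightarrow> 'k \<Rightarrow> 'k::ab_group_add) \<Rightarrow> 'k set \<Rightarrow> ('m \<Rightarrow> 'k) \<Rightarrow> bool"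
  where "is_resolution s B d t M eps \<longleftrightarrow>
    left_module t M \<and>
    (\<forall>k. left_module s (B k)) \<and>
    (\<forall>k\<ge>1. module_hom_on s (B k) s (B (k - 1)) (d k)) \<and>
    module_hom_on s (B 0) t M eps \<and>
    eps ` B 0 = M \<and>
    d 1 ` B 1 = {x \<in> B 0. eps x = 0} \<and>
    (\<forall>k\<ge>1. d (k + 1) ` B (k + 1) = {x \<in> B k. d k x = 0})"

definition free_smult :: "'e \<Rightarrow> ('s \<Rightarrow>\<^sub>0 'e) \<Rightarrow> ('s \<Rightarrow>\<^sub>0 'e::{ring, monoid_mult})"
  where "free_smult a p = Poly_Mapping.map (\<lambda>x. a * x) p"

definition free_module :: "'s set \<Rightarrow> ('s \<Rightarrow>\<^sub>0 'e::{ring, monoid_mult}) set"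
  where "free_module S = {p. Poly_Mapping.keys p \<subseteq> S}"

definition free_gen :: "'s \<Rightarrow> ('s \<Rightarrow>\<^sub>0 'e::{ring, monoid_mult})"
  where "free_gen s = Poly_Mapping.single s 1"

lemma lookup_free_smult [simp]:
  "Poly_Mapping.lookup (free_smult a p) s = a * Poly_Mapping.lookup p s"
  unfolding free_smult_def by transfer (auto simp: when_def)

lemma left_module_free_module: "left_module free_smult (free_module S)"
proof
  fix x y :: "'b \<Rightarrow>\<^sub>0 'a" and a b :: 'a
  assume x: "x \<in> free_module S"
  show "free_smult a x \<in> free_module S"
    using x by (auto simp: free_module_def in_keys_iff subset_iff) (metis mult_zero_right)
  show "free_smult (a + b) x = free_smult a x + free_smult b x"
    by (rule poly_mapping_eqI) (simp add: lookup_add distrib_right)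
  show "free_smult (a * b) x = free_smult a (free_smult b x)"
    by (rule poly_mapping_eqI) (simp add: mult.assoc)
  show "free_smult 1 x = x"
    by (rule poly_mapping_eqI) simp
  show "- x \<in> free_module S"
    using x by (auto simp: free_module_def in_keys_iff)
  assume y: "y \<in> free_module S"
  show "x + y \<in> free_module S"
    using x y by (auto simp: free_module_def in_keys_iff subset_iff lookup_add) (metis add_0)
  show "free_smult a (x + y) = free_smult a x + free_smult a y"
    by (rule poly_mapping_eqI) (simp add: lookup_add distrib_left)
qed (simp add: free_module_def)

lemma free_module_expand:
  assumes "finite S" "p \<in> free_module S"
  shows "p = (\<Sum>s\<in>S. free_smult (Poly_Mapping.lookup p s) (free_gen s))"
proof (rule poly_mapping_eqI)
  fix k
  have "(\<Sum>s\<in>S. Poly_Mapping.lookup p s * Poly_Mapping.lookup (free_gen s) k)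
      = (\<Sum>s\<in>S. if s = k then Poly_Mapping.lookup p s else 0)"
    by (rule sum.cong) (auto simp: free_gen_def lookup_single when_def)
  also have "\<dots> = Poly_Mapping.lookup p k"
    using assms by (auto simp: free_module_def in_keys_iff)
  finally show "Poly_Mapping.lookup p k =
      Poly_Mapping.lookup (\<Sum>s\<in>S. free_smult (Poly_Mapping.lookup p s) (free_gen s)) k"
    by (simp add: lookup_sum)
qed


section \<open>The exterior algebra\<close>

(* An element is its family of coefficients with respect to the basis x_sigma, sigma a subset of [n]. *)
typedef ('n, 'r) ext = "UNIV :: ('n set \<Rightarrow> 'r) set"
  morphisms ext_coeff Abs_ext ..

lemma ext_coeff_Abs [simp]: "ext_coeff (Abs_ext f) = f"
  by (simp add: Abs_ext_inverse)

lemma ext_eqI: "(\<And>\<sigma>. ext_coeff a \<sigma> = ext_coeff b \<sigma>) \<Longrightarrow> a = b"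
  by (simp add: ext_coeff_inject[symmetric] fun_eq_iff)

instantiation ext :: (type, ab_group_add) ab_group_add
begin
definition zero_ext :: "('a, 'b) ext" where "zero_ext = Abs_ext (\<lambda>\<sigma>. 0)"
definition plus_ext :: "('a, 'b) ext \<Rightarrow> ('a, 'b) ext \<Rightarrow> ('a, 'b) ext"
  where "plus_ext a b = Abs_ext (\<lambda>\<sigma>. ext_coeff a \<sigma> + ext_coeff b \<sigma>)"
definition minus_ext :: "('a, 'b) ext \<Rightarrow> ('a, 'b) ext \<Rightarrow> ('a, 'b) ext"
  where "minus_ext a b = Abs_ext (\<lambda>\<sigma>. ext_coeff a \<sigma> - ext_coeff b \<sigma>)"
definition uminus_ext :: "('a, 'b) ext \<Rightarrow> ('a, 'b) ext"
  where "uminus_ext a = Abs_ext (\<lambda>\<sigma>. - ext_coeff a \<sigma>)"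
instance
  by standard
    (auto intro!: ext_eqI simp: zero_ext_def plus_ext_def minus_ext_def uminus_ext_def algebra_simps)
end

lemma ext_coeff_simps [simp]:
  "ext_coeff 0 \<sigma> = 0"
  "ext_coeff (a + b) \<sigma> = ext_coeff a \<sigma> + ext_coeff b \<sigma>"
  "ext_coeff (a - b) \<sigma> = ext_coeff a \<sigma> - ext_coeff b \<sigma>"
  "ext_coeff (- a) \<sigma> = - ext_coeff a \<sigma>"
  by (simp_all add: zero_ext_def plus_ext_def minus_ext_def uminus_ext_def)

lemma ext_coeff_sum [simp]: "ext_coeff (sum f I) \<sigma> = (\<Sum>i\<in>I. ext_coeff (f i) \<sigma>)"
  by (induction I rule: infinite_finite_induct) auto

definition ext_smult :: "'r \<Rightarrow> ('n, 'r) ext \<Rightarrow> ('n, 'r::{comm_ring, comm_monoid_mult}) ext"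
  where "ext_smult r a = Abs_ext (\<lambda>\<sigma>. r * ext_coeff a \<sigma>)"

definition ext_basis :: "'n set \<Rightarrow> ('n, 'r::{comm_ring, comm_monoid_mult}) ext"
  where "ext_basis \<sigma> = Abs_ext (\<lambda>\<rho>. if \<rho> = \<sigma> then 1 else 0)"

definition ext_gen :: "'n \<Rightarrow> ('n, 'r::{comm_ring, comm_monoid_mult}) ext"
  where "ext_gen i = ext_basis {i}"

lemma ext_coeff_smult [simp]: "ext_coeff (ext_smult r a) \<sigma> = r * ext_coeff a \<sigma>"
  by (simp add: ext_smult_def)

lemma ext_coeff_basis: "ext_coeff (ext_basis \<sigma>) \<rho> = (if \<rho> = \<sigma> then 1 else 0)"
  by (simp add: ext_basis_def)

definition inversions :: "'n::linorder set \<Rightarrow> 'n set \<Rightarrow> nat"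
  where "inversions \<sigma> \<rho> = card {(i, j). i \<in> \<sigma> \<and> j \<in> \<rho> \<and> j < i}"

(* The product x_sigma x_rho: moving the factors into increasing order costs one sign per inversion. *)
definition ext_basis_mult ::
  "'n::linorder set \<Rightarrow> 'n set \<Rightarrow> ('n, 'r::{comm_ring, comm_monoid_mult}) ext"
  where "ext_basis_mult \<sigma> \<rho> =
    (if \<sigma> \<inter> \<rho> = {} then ext_smult ((- 1) ^ inversions \<sigma> \<rho>) (ext_basis (\<sigma> \<union> \<rho>)) else 0)"

lemma inversions_Un_left:
  fixes \<sigma> :: "'n::{finite, linorder} set"
  assumes "\<sigma> \<inter> \<rho> = {}"
  shows "inversions (\<sigma> \<union> \<rho>) \<tau> = inversions \<sigma> \<tau> + inversions \<rho> \<tau>"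
proof -
  have "{(i, j). i \<in> \<sigma> \<union> \<rho> \<and> j \<in> \<tau> \<and> j < i}
      = {(i, j). i \<in> \<sigma> \<and> j \<in> \<tau> \<and> j < i} \<union> {(i, j). i \<in> \<rho> \<and> j \<in> \<tau> \<and> j < i}"
    by auto
  then show ?thesis
    unfolding inversions_def using assms by (subst card_Un_disjoint[symmetric]) auto
qed

lemma inversions_Un_right:
  fixes \<sigma> :: "'n::{finite, linorder} set"
  assumes "\<rho> \<inter> \<tau> = {}"
  shows "inversions \<sigma> (\<rho> \<union> \<tau>) = inversions \<sigma> \<rho> + inversions \<sigma> \<tau>"
proof -
  have "{(i, j). i \<in> \<sigma> \<and> j \<in> \<rho> \<union> \<tau> \<and> j < i}
      = {(i, j). i \<in> \<sigma> \<and> j \<in> \<rho> \<and> j < i} \<union> {(i, j). i \<in> \<sigma> \<and> j \<in> \<tau> \<and> j < i}"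
    by auto
  then show ?thesis
    unfolding inversions_def using assms by (subst card_Un_disjoint[symmetric]) auto
qed

lemma inversions_empty [simp]: "inversions {} \<sigma> = 0" "inversions \<sigma> {} = 0"
  by (simp_all add: inversions_def)

lemma ext_smult_simps:
  fixes a b :: "('n, 'r::{comm_ring, comm_monoid_mult}) ext"
  shows "ext_smult r (a + b) = ext_smult r a + ext_smult r b"
    "ext_smult (r + s) a = ext_smult r a + ext_smult s a"
    "ext_smult r (ext_smult s a) = ext_smult (r * s) a"
    "ext_smult 1 a = a" "ext_smult r 0 = 0" "ext_smult 0 a = 0"
  by (auto intro!: ext_eqI simp: algebra_simps)

lemma ext_smult_sum: "ext_smult r (sum f I) = (\<Sum>i\<in>I. ext_smult r (f i))"
  by (rule ext_eqI) (simp add: sum_distrib_left)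

lemma ext_expand:
  fixes a :: "('n::finite, 'r::{comm_ring, comm_monoid_mult}) ext"
  shows "a = (\<Sum>\<sigma>\<in>UNIV. ext_smult (ext_coeff a \<sigma>) (ext_basis \<sigma>))"
  by (rule ext_eqI) (simp add: ext_coeff_basis if_distrib[of "\<lambda>x. _ * x"] cong: if_cong)

instantiation ext :: ("{finite, linorder}", "{comm_ring, comm_monoid_mult}") "{one, times}"
begin
definition one_ext :: "('a, 'b) ext" where "one_ext = ext_basis {}"
definition times_ext :: "('a, 'b) ext \<Rightarrow> ('a, 'b) ext \<Rightarrow> ('a, 'b) ext"
  where "times_ext a b =
    (\<Sum>\<sigma>\<in>UNIV. \<Sum>\<rho>\<in>UNIV. ext_smult (ext_coeff a \<sigma> * ext_coeff b \<rho>) (ext_basis_mult \<sigma> \<rho>))"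
instance ..
end

context
  fixes a b c :: "('n::{finite, linorder}, 'r::{comm_ring, comm_monoid_mult}) ext"
begin

lemma ext_mult_add: "(a + b) * c = a * c + b * c" "a * (b + c) = a * b + a * c"
  by (simp_all add: times_ext_def distrib_left distrib_right ext_smult_simps sum.distrib)

lemma ext_mult_zero: "0 * a = 0" "a * 0 = 0"
  by (simp_all add: times_ext_def ext_smult_simps)

lemma ext_mult_smult: "ext_smult r a * b = ext_smult r (a * b)" "a * ext_smult r b = ext_smult r (a * b)"
  by (simp_all add: times_ext_def ext_smult_simps ext_smult_sum mult_ac)

end

lemma ext_mult_sum:
  fixes a :: "('n::{finite, linorder}, 'r::{comm_ring, comm_monoid_mult}) ext"
  shows "sum f I * a = (\<Sum>i\<in>I. f i * a)" "a * sum f I = (\<Sum>i\<in>I. a * f i)"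
  by (induction I rule: infinite_finite_induct) (simp_all add: ext_mult_add ext_mult_zero)

lemma ext_basis_times_basis: "ext_basis \<sigma> * ext_basis \<rho> = ext_basis_mult \<sigma> \<rho>"
proof -
  have "(\<Sum>\<rho>'\<in>UNIV. ext_smult (ext_coeff (ext_basis \<sigma>) \<sigma>' * ext_coeff (ext_basis \<rho>) \<rho>') (ext_basis_mult \<sigma>' \<rho>'))
      = (\<Sum>\<rho>'\<in>UNIV. if \<rho>' = \<rho> then (if \<sigma>' = \<sigma> then ext_basis_mult \<sigma> \<rho> else (0 :: ('a, 'b) ext)) else 0)" for \<sigma>'
    by (rule sum.cong) (auto simp: ext_coeff_basis ext_smult_simps)
  then show ?thesis by (simp add: times_ext_def)
qed

instance ext :: ("{finite, linorder}", "{comm_ring, comm_monoid_mult}") "{ring, monoid_mult}"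
proof
  fix a b c :: "('a, 'b) ext"
  have assoc0: "ext_basis \<sigma> * ext_basis \<rho> * ext_basis \<tau> = (ext_basis \<sigma> * (ext_basis \<rho> * ext_basis \<tau>) :: ('a, 'b) ext)"
    for \<sigma> \<rho> \<tau>
    by (auto simp: ext_basis_times_basis ext_basis_mult_def ext_mult_smult ext_mult_zero ext_smult_simps
        Int_Un_distrib Int_Un_distrib2 inversions_Un_left inversions_Un_right power_add mult_ac Un_assoc)
  have assoc1: "a * ext_basis \<rho> * ext_basis \<tau> = a * (ext_basis \<rho> * ext_basis \<tau>)" for a :: "('a, 'b) ext" and \<rho> \<tau>
    by (subst (1 2) ext_expand[of a]) (simp add: ext_mult_sum ext_mult_smult assoc0)
  have assoc2: "a * b * ext_basis \<tau> = a * (b * ext_basis \<tau>)" for a b :: "('a, 'b) ext" and \<tau>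
    by (subst (1 2) ext_expand[of b]) (simp add: ext_mult_sum ext_mult_smult assoc1)
  show "a * b * c = a * (b * c)"
    by (subst (1 2) ext_expand[of c]) (simp add: ext_mult_sum ext_mult_smult assoc2)
  show "(a + b) * c = a * c + b * c" "a * (b + c) = a * b + a * c" by (rule ext_mult_add)+
  have one_b: "1 * ext_basis \<sigma> = (ext_basis \<sigma> :: ('a, 'b) ext)" "ext_basis \<sigma> * 1 = (ext_basis \<sigma> :: ('a, 'b) ext)" for \<sigma>
    by (simp_all add: one_ext_def ext_basis_times_basis ext_basis_mult_def ext_smult_simps)
  let ?a = "\<Sum>\<sigma>\<in>UNIV. ext_smult (ext_coeff a \<sigma>) (ext_basis \<sigma>)"
  have "1 * ?a = ?a" "?a * 1 = ?a" by (simp_all only: ext_mult_sum ext_mult_smult one_b)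
  then show "1 * a = a" "a * 1 = a" by (simp_all flip: ext_expand)
qed

lemma ext_gen_square: "ext_gen i * ext_gen i = 0"
  by (simp add: ext_gen_def ext_basis_times_basis ext_basis_mult_def)

lemma ext_gen_anticommute: "ext_gen i * ext_gen j = - (ext_gen j * ext_gen i)"
proof -
  have inv: "inversions {i} {j} = (if j < i then 1 else 0)" for i j :: 'a
  proof -
    have "{(k, l). k \<in> {i} \<and> l \<in> {j} \<and> l < k} = (if j < i then {(i, j)} else {})" by auto
    then show ?thesis unfolding inversions_def by (simp split: if_splits)
  qed
  show ?thesis
    by (cases i j rule: linorder_cases)
      (auto intro!: ext_eqI
        simp: ext_gen_def ext_basis_times_basis ext_basis_mult_def inv insert_commute ext_smult_simps)
qed

lemma ext_basis_prod_list:
  "(ext_basis \<sigma> :: ('n::{finite, linorder}, 'r::{comm_ring, comm_monoid_mult}) ext) =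
    prod_list (map ext_gen (sorted_list_of_set \<sigma>))"
proof -
  have "sorted_wrt (<) xs \<Longrightarrow>
      (ext_basis (set xs) :: ('n, 'r) ext) = prod_list (map ext_gen xs)" for xs :: "'n list"
  proof (induction xs)
    case Nil
    show ?case by (simp add: one_ext_def)
  next
    case (Cons i xs)
    then have "{(k, l). k \<in> {i} \<and> l \<in> set xs \<and> l < k} = {}" "i \<notin> set xs" by fastforce+
    then have "inversions {i} (set xs) = 0" unfolding inversions_def by simp
    then have "ext_gen i * ext_basis (set xs) = (ext_basis (set (i # xs)) :: ('n, 'r) ext)"
      using \<open>i \<notin> set xs\<close>
      by (simp add: ext_gen_def ext_basis_times_basis ext_basis_mult_def ext_smult_simps)
    moreover have "ext_basis (set xs) = (prod_list (map ext_gen xs) :: ('n, 'r) ext)"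
      using Cons by simp
    ultimately show ?case by simp
  qed
  from this[of "sorted_list_of_set \<sigma>"] show ?thesis by simp
qed


section \<open>The enveloping algebra\<close>

(* Since A is R-free on the x_sigma, its enveloping algebra (the tensor product of A and its opposite)
   is R-free on the x_sigma (x) x_rho; an element is its family of coefficients with respect to this
   basis. The universal property is lemma tensor_universal, the product is lemma tensor_times_tensor. *)
typedef ('n, 'r) env = "UNIV :: ('n set \<times> 'n set \<Rightarrow> 'r) set"
  morphisms env_coeff Abs_env ..

lemma env_coeff_Abs [simp]: "env_coeff (Abs_env f) = f"
  by (simp add: Abs_env_inverse)

lemma env_eqI: "(\<And>p. env_coeff u p = env_coeff v p) \<Longrightarrow> u = v"
  by (simp add: env_coeff_inject[symmetric] fun_eq_iff)

instantiation env :: (type, ab_group_add) ab_group_add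
begin
definition zero_env :: "('a, 'b) env" where "zero_env = Abs_env (\<lambda>p. 0)"
definition plus_env :: "('a, 'b) env \<Rightarrow> ('a, 'b) env \<Rightarrow> ('a, 'b) env"
  where "plus_env u v = Abs_env (\<lambda>p. env_coeff u p + env_coeff v p)"
definition minus_env :: "('a, 'b) env \<Rightarrow> ('a, 'b) env \<Rightarrow> ('a, 'b) env"
  where "minus_env u v = Abs_env (\<lambda>p. env_coeff u p - env_coeff v p)"
definition uminus_env :: "('a, 'b) env \<Rightarrow> ('a, 'b) env"
  where "uminus_env u = Abs_env (\<lambda>p. - env_coeff u p)"
instance
  by standard
    (auto intro!: env_eqI simp: zero_env_def plus_env_def minus_env_def uminus_env_def algebra_simps)
end

lemma env_coeff_simps [simp]:
  "env_coeff 0 p = 0"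
  "env_coeff (u + v) p = env_coeff u p + env_coeff v p"
  "env_coeff (u - v) p = env_coeff u p - env_coeff v p"
  "env_coeff (- u) p = - env_coeff u p"
  by (simp_all add: zero_env_def plus_env_def minus_env_def uminus_env_def)

lemma env_coeff_sum [simp]: "env_coeff (sum f I) p = (\<Sum>i\<in>I. env_coeff (f i) p)"
  by (induction I rule: infinite_finite_induct) auto

definition env_smult :: "'r \<Rightarrow> ('n, 'r) env \<Rightarrow> ('n, 'r::{comm_ring, comm_monoid_mult}) env"
  where "env_smult r u = Abs_env (\<lambda>p. r * env_coeff u p)"

definition tensor :: "('n, 'r) ext \<Rightarrow> ('n, 'r) ext \<Rightarrow> ('n, 'r::{comm_ring, comm_monoid_mult}) env"
  where "tensor a b = Abs_env (\<lambda>(\<sigma>, \<rho>). ext_coeff a \<sigma> * ext_coeff b \<rho>)"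

lemma env_coeff_smult [simp]: "env_coeff (env_smult r u) p = r * env_coeff u p"
  by (simp add: env_smult_def)

lemma env_coeff_tensor [simp]: "env_coeff (tensor a b) p = ext_coeff a (fst p) * ext_coeff b (snd p)"
  by (simp add: tensor_def case_prod_beta)

lemma env_smult_simps:
  fixes u v :: "('n, 'r::{comm_ring, comm_monoid_mult}) env"
  shows "env_smult r (u + v) = env_smult r u + env_smult r v"
    "env_smult (r + s) u = env_smult r u + env_smult s u"
    "env_smult r (env_smult s u) = env_smult (r * s) u"
    "env_smult 1 u = u" "env_smult r 0 = 0" "env_smult 0 u = 0"
  by (auto intro!: env_eqI simp: algebra_simps)

lemma env_smult_sum: "env_smult r (sum f I) = (\<Sum>i\<in>I. env_smult r (f i))"
  by (rule env_eqI) (simp add: sum_distrib_left)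

lemma tensor_bilinear:
  fixes a b :: "('n, 'r::{comm_ring, comm_monoid_mult}) ext"
  shows "tensor (a + a') b = tensor a b + tensor a' b"
    "tensor a (b + b') = tensor a b + tensor a b'"
    "tensor (ext_smult r a) b = env_smult r (tensor a b)"
    "tensor a (ext_smult r b) = env_smult r (tensor a b)"
    "tensor 0 b = 0" "tensor a 0 = 0"
  by (auto intro!: env_eqI simp: algebra_simps)

lemma tensor_sum:
  fixes a b :: "('n, 'r::{comm_ring, comm_monoid_mult}) ext"
  shows "tensor (sum f I) b = (\<Sum>i\<in>I. tensor (f i) b)" "tensor a (sum f I) = (\<Sum>i\<in>I. tensor a (f i))"
  by (induction I rule: infinite_finite_induct) (simp_all add: tensor_bilinear)

lemma env_expand:
  fixes u :: "('n::finite, 'r::{comm_ring, comm_monoid_mult}) env"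
  shows "u = (\<Sum>p\<in>UNIV. env_smult (env_coeff u p) (tensor (ext_basis (fst p)) (ext_basis (snd p))))"
proof (rule env_eqI)
  fix q
  have "(\<Sum>p\<in>UNIV. env_coeff u p * (ext_coeff (ext_basis (fst p)) (fst q) * ext_coeff (ext_basis (snd p)) (snd q)))
      = (\<Sum>p\<in>UNIV. if p = q then env_coeff u q else 0)"
    by (rule sum.cong) (auto simp: ext_coeff_basis prod_eq_iff)
  then show "env_coeff u q =
      env_coeff (\<Sum>p\<in>UNIV. env_smult (env_coeff u p) (tensor (ext_basis (fst p)) (ext_basis (snd p)))) q"
    by simp
qed

lemma tensor_universal:
  fixes s :: "'r::{comm_ring, comm_monoid_mult} \<Rightarrow> 'm::ab_group_add \<Rightarrow> 'm"
    and f :: "('n::finite, 'r) ext \<Rightarrow> ('n, 'r) ext \<Rightarrow> 'm"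
  assumes M: "left_module s UNIV"
    and f: "\<And>b. module_hom_on ext_smult UNIV s UNIV (\<lambda>a. f a b)"
      "\<And>a. module_hom_on ext_smult UNIV s UNIV (f a)"
  shows "\<exists>!g. module_hom_on env_smult UNIV s UNIV g \<and> (\<forall>a b. g (tensor a b) = f a b)"
proof
  let ?f = "\<lambda>p. f (ext_basis (fst p)) (ext_basis (snd p))"
  let ?g = "\<lambda>u. \<Sum>p\<in>UNIV. s (env_coeff u p) (?f p)"
  interpret left_module s UNIV by (rule M)
  have s0: "s r 0 = 0" for r using smult_add_right[of 0 0 r] by simp
  have s_sum: "s r (sum h I) = (\<Sum>i\<in>I. s r (h i))" for r I and h :: "'i \<Rightarrow> 'm"
    by (induction I rule: infinite_finite_induct) (simp_all add: s0 smult_add_right)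
  have hom_sum: "h (sum k I) = (\<Sum>i\<in>I. h (k i))"
    if "\<And>x y. h (x + y) = h x + h y" for h :: "'x::ab_group_add \<Rightarrow> 'm" and k :: "'i \<Rightarrow> 'x" and I
  proof -
    have "h 0 = 0" using that[of 0 0] by simp
    then show ?thesis by (induction I rule: infinite_finite_induct) (simp_all add: that)
  qed
  have fa: "f (a + a') b = f a b + f a' b" "f a (b + b') = f a b + f a b'"
    "f (ext_smult r a) b = s r (f a b)" "f a (ext_smult r b) = s r (f a b)" for a a' b b' r
    using f by (auto simp: module_hom_on_def)
  have "?g (tensor a b) = f a b" for a b
  proof -
    have "f a b = f (\<Sum>\<sigma>\<in>UNIV. ext_smult (ext_coeff a \<sigma>) (ext_basis \<sigma>))
        (\<Sum>\<rho>\<in>UNIV. ext_smult (ext_coeff b \<rho>) (ext_basis \<rho>))"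
      by (simp flip: ext_expand)
    also have "\<dots> = (\<Sum>\<sigma>\<in>UNIV. \<Sum>\<rho>\<in>UNIV. s (ext_coeff a \<sigma>) (s (ext_coeff b \<rho>) (f (ext_basis \<sigma>) (ext_basis \<rho>))))"
      by (subst sum.swap)
        (simp add: hom_sum[of "\<lambda>a. f a _"] hom_sum[of "f _"] fa s_sum mult.commute flip: smult_smult)
    also have "\<dots> = ?g (tensor a b)"
      by (simp add: sum.cartesian_product smult_smult case_prod_beta flip: UNIV_Times_UNIV)
    finally show ?thesis ..
  qed
  moreover have "module_hom_on env_smult UNIV s UNIV ?g"
    by (auto simp: module_hom_on_def smult_add_left sum.distrib smult_smult s_sum)
  ultimately show "module_hom_on env_smult UNIV s UNIV ?g \<and> (\<forall>a b. ?g (tensor a b) = f a b)"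
    by blast
  fix g assume g: "module_hom_on env_smult UNIV s UNIV g \<and> (\<forall>a b. g (tensor a b) = f a b)"
  show "g = ?g"
  proof
    fix u
    have "g u = g (\<Sum>p\<in>UNIV. env_smult (env_coeff u p) (tensor (ext_basis (fst p)) (ext_basis (snd p))))"
      by (simp flip: env_expand)
    also have "\<dots> = ?g u"
      using g by (subst hom_sum) (auto simp: module_hom_on_def)
    finally show "g u = ?g u" .
  qed
qed

(* The product of x_sigma (x) x_rho and x_sigma' (x) x_rho' is x_sigma x_sigma' (x) x_rho' x_rho,
   with no sign: the second factor is the opposite algebra, and the tensor product is the ungraded one. *)
instantiation env :: ("{finite, linorder}", "{comm_ring, comm_monoid_mult}") "{one, times}"
begin
definition one_env :: "('a, 'b) env" where "one_env = tensor 1 1"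
definition times_env :: "('a, 'b) env \<Rightarrow> ('a, 'b) env \<Rightarrow> ('a, 'b) env"
  where "times_env u v = (\<Sum>p\<in>UNIV. \<Sum>q\<in>UNIV. env_smult (env_coeff u p * env_coeff v q)
    (tensor (ext_basis (fst p) * ext_basis (fst q)) (ext_basis (snd q) * ext_basis (snd p))))"
instance ..
end

context
  fixes u v w :: "('n::{finite, linorder}, 'r::{comm_ring, comm_monoid_mult}) env"
begin

lemma env_mult_add: "(u + v) * w = u * w + v * w" "u * (v + w) = u * v + u * w"
  by (simp_all add: times_env_def distrib_left distrib_right env_smult_simps sum.distrib)

lemma env_mult_zero: "0 * u = 0" "u * 0 = 0"
  by (simp_all add: times_env_def env_smult_simps)

lemma env_mult_smult: "env_smult r u * v = env_smult r (u * v)" "u * env_smult r v = env_smult r (u * v)"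
  by (simp_all add: times_env_def env_smult_simps env_smult_sum mult_ac)

end

lemma env_mult_sum:
  fixes u :: "('n::{finite, linorder}, 'r::{comm_ring, comm_monoid_mult}) env"
  shows "sum f I * u = (\<Sum>i\<in>I. f i * u)" "u * sum f I = (\<Sum>i\<in>I. u * f i)"
  by (induction I rule: infinite_finite_induct) (simp_all add: env_mult_add env_mult_zero)

lemma tensor_times_tensor:
  fixes a b c d :: "('n::{finite, linorder}, 'r::{comm_ring, comm_monoid_mult}) ext"
  shows "tensor a b * tensor c d = tensor (a * c) (d * b)"
proof -
  let ?X = "\<lambda>\<sigma>. ext_basis \<sigma> :: ('n, 'r) ext"
  let ?T = "\<lambda>p q. tensor (?X (fst p) * ?X (fst q)) (?X (snd q) * ?X (snd p))"
  note lin = ext_mult_sum ext_mult_smult tensor_sum tensor_bilinear env_mult_sum env_mult_smult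
  have "tensor (?X \<sigma>) (?X \<rho>) * tensor (?X \<sigma>') (?X \<rho>') = tensor (?X \<sigma> * ?X \<sigma>') (?X \<rho>' * ?X \<rho>)"
    for \<sigma> \<rho> \<sigma>' \<rho>'
  proof -
    have "(\<Sum>q\<in>UNIV. env_smult (env_coeff (tensor (?X \<sigma>) (?X \<rho>)) p * env_coeff (tensor (?X \<sigma>') (?X \<rho>')) q) (?T p q))
        = (\<Sum>q\<in>UNIV. if q = (\<sigma>', \<rho>') then (if p = (\<sigma>, \<rho>) then ?T p q else 0) else 0)" for p
      by (rule sum.cong) (auto simp: ext_coeff_basis env_smult_simps prod_eq_iff)
    then show ?thesis by (simp add: times_env_def)
  qed
  then have "tensor a (?X \<rho>) * tensor (?X \<sigma>') (?X \<rho>') = tensor (a * ?X \<sigma>') (?X \<rho>' * ?X \<rho>)" for \<rho> \<sigma>' \<rho>'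
    by (subst (1 2) ext_expand[of a]) (simp add: lin)
  then have "tensor a b * tensor (?X \<sigma>') (?X \<rho>') = tensor (a * ?X \<sigma>') (?X \<rho>' * b)" for \<sigma>' \<rho>'
    by (subst (1 2) ext_expand[of b]) (simp add: lin)
  then have "tensor a b * tensor c (?X \<rho>') = tensor (a * c) (?X \<rho>' * b)" for \<rho>'
    by (subst (1 2) ext_expand[of c]) (simp add: lin)
  then show ?thesis
    by (subst (1 2) ext_expand[of d]) (simp add: lin)
qed

instance env :: ("{finite, linorder}", "{comm_ring, comm_monoid_mult}") "{ring, monoid_mult}"
proof
  fix u v w :: "('a, 'b) env"
  let ?E = "\<lambda>p. tensor (ext_basis (fst p)) (ext_basis (snd p)) :: ('a, 'b) env"
  note lin = env_mult_sum env_mult_smult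
  have assoc1: "u * ?E p * ?E q = u * (?E p * ?E q)" for u p q
    by (subst (1 2) env_expand[of u]) (simp add: lin tensor_times_tensor mult.assoc)
  have assoc2: "u * v * ?E q = u * (v * ?E q)" for u v q
    by (subst (1 2) env_expand[of v]) (simp add: lin assoc1)
  show "u * v * w = u * (v * w)"
    by (subst (1 2) env_expand[of w]) (simp add: lin assoc2)
  show "(u + v) * w = u * w + v * w" "u * (v + w) = u * v + u * w" by (rule env_mult_add)+
  let ?u = "\<Sum>p\<in>UNIV. env_smult (env_coeff u p) (?E p)"
  have "1 * ?u = ?u" "?u * 1 = ?u"
    by (simp_all only: one_env_def lin tensor_times_tensor mult_1_left mult_1_right)
  then show "1 * u = u" "u * 1 = u" by (simp_all flip: env_expand)
qed

(* The action of the enveloping algebra on A, extending lemma env_act_tensor linearly. *)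
definition env_act ::
  "('n, 'r) env \<Rightarrow> ('n, 'r) ext \<Rightarrow> ('n::{finite, linorder}, 'r::{comm_ring, comm_monoid_mult}) ext"
  where "env_act u a =
    (\<Sum>p\<in>UNIV. ext_smult (env_coeff u p) (ext_basis (fst p) * a * ext_basis (snd p)))"

lemma env_act_tensor: "env_act (tensor \<alpha> \<beta>) a = \<alpha> * a * \<beta>"
proof -
  have "\<alpha> * a * \<beta> = (\<Sum>\<sigma>\<in>UNIV. ext_smult (ext_coeff \<alpha> \<sigma>) (ext_basis \<sigma>)) * a *
      (\<Sum>\<rho>\<in>UNIV. ext_smult (ext_coeff \<beta> \<rho>) (ext_basis \<rho>))"
    by (simp flip: ext_expand)
  also have "\<dots> = (\<Sum>\<sigma>\<in>UNIV. \<Sum>\<rho>\<in>UNIV.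
      ext_smult (ext_coeff \<alpha> \<sigma> * ext_coeff \<beta> \<rho>) (ext_basis \<sigma> * a * ext_basis \<rho>))"
    by (subst sum.swap) (simp add: ext_mult_sum ext_mult_smult ext_smult_simps ext_smult_sum mult.commute)
  also have "\<dots> = env_act (tensor \<alpha> \<beta>) a"
    by (simp add: env_act_def sum.cartesian_product case_prod_beta flip: UNIV_Times_UNIV)
  finally show ?thesis ..
qed

end

theory Submission
  imports Defs
begin

text \<open>
  The boundary is a sum of mutually anticommuting differentials, one for each generator \<open>x\<^sub>i\<close>.
  Let \<open>c\<^sub>i\<close> be the right contraction by \<open>x\<^sub>i\<close> on the first tensor factor. The map \<open>s\<^sub>i\<close> sending
  \<open>u x\<^sub>(\<^sub>\<tau>\<^sub>)\<close> to \<open>c\<^sub>i(u) x\<^sub>(\<^sub>\<tau>\<^sub>+\<^sub>i\<^sub>)\<close> anticommutes with the differentials of the other generators, and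
  \<open>1 - (b s\<^sub>i + s\<^sub>i b)\<close> projects to the elements that involve no \<open>x\<^sub>(\<^sub>\<tau>\<^sub>)\<close> with \<open>i \<in> \<tau>\<close> and whose
  coefficients are killed by \<open>c\<^sub>i\<close>. Applying these projections for all \<open>i\<close> replaces a cycle by a
  homologous one of the form \<open>(1 \<otimes> c) x\<^sub>(\<^sub>\<emptyset>\<^sub>)\<close>, which is zero in positive degree, and also in degree 0
  if the augmentation kills it, since its augmentation is \<open>c\<close>.
\<close>

section \<open>Signs and antisymmetric double sums\<close>

lemma neg_one_power: "(- 1 :: 'a::{ring, monoid_mult}) ^ k = (if even k then 1 else - 1)"
  by (induction k) auto

lemma neg_one_power_cancel: "(- 1) ^ k * ((- 1) ^ k * x) = (x :: 'a::{ring, monoid_mult})"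
  by (simp add: neg_one_power)

text \<open>The row and the column of each new index cancel. The diagonal is a separate assumption,
  since \<open>f i i + f i i = 0\<close> does not force \<open>f i i = 0\<close> in the presence of
  2-torsion.\<close>

lemma sum_antisymmetric:
  fixes f :: "'i \<Rightarrow> 'i \<Rightarrow> 'a::ab_group_add"
  assumes "finite I" "\<And>i j. f i j + f j i = 0" "\<And>i. f i i = 0"
  shows "(\<Sum>i\<in>I. \<Sum>j\<in>I. f i j) = 0"
  using assms(1)
proof induction
  case (insert a I)
  have "(\<Sum>i\<in>I. f a i) + (\<Sum>i\<in>I. f i a) = 0"
    by (simp add: assms(2) flip: sum.distrib)
  with insert show ?case
    by (simp add: assms(3) sum.distrib add.commute)
qed simp


section \<open>Contractions\<close>

text \<open>The sign exponent: how many factors of \<open>x_\<sigma>\<close> the generator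
  \<open>x_i\<close> passes on its way from the right end to its sorted place.\<close>

definition above :: "'n::linorder \<Rightarrow> 'n set \<Rightarrow> nat"
  where "above i \<sigma> = card {l\<in>\<sigma>. i < l}"

lemma above_insert:
  fixes \<sigma> :: "'n::{finite, linorder} set"
  assumes "i \<notin> \<sigma>"
  shows "above j (insert i \<sigma>) = above j \<sigma> + (if j < i then 1 else 0)"
proof -
  have "{l \<in> insert i \<sigma>. j < l} = (if j < i then insert i {l\<in>\<sigma>. j < l} else {l\<in>\<sigma>. j < l})" by auto
  with assms show ?thesis by (simp add: above_def)
qed

lemma above_remove_self [simp]: "above j (\<sigma> - {j}) = above j \<sigma>"
proof -
  have "{l \<in> \<sigma> - {j}. j < l} = {l \<in> \<sigma>. j < l}" by auto
  then show ?thesis by (simp add: above_def)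
qed

text \<open>The sign is chosen so that \<open>x_\<sigma> * x_i\<close> contracts to
  \<open>x_\<sigma>\<close> when \<open>i \<notin> \<sigma>\<close>.\<close>

definition ext_contr :: "'n \<Rightarrow> ('n, 'r) ext \<Rightarrow> ('n::{finite, linorder}, 'r::{comm_ring, comm_monoid_mult}) ext"
  where "ext_contr i a =
    Abs_ext (\<lambda>\<sigma>. if i \<in> \<sigma> then 0 else (- 1) ^ above i \<sigma> * ext_coeff a (insert i \<sigma>))"

lemma ext_coeff_times_gen:
  fixes a :: "('n::{finite, linorder}, 'r::{comm_ring, comm_monoid_mult}) ext"
  shows "ext_coeff (a * ext_gen j) \<sigma> =
    (if j \<in> \<sigma> then (- 1) ^ above j \<sigma> * ext_coeff a (\<sigma> - {j}) else 0)"
proof -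
  have inv: "inversions \<rho> {j} = above j \<rho>" for \<rho> :: "'n set"
  proof -
    have "{(k, l). k \<in> \<rho> \<and> l \<in> {j} \<and> l < k} = (\<lambda>k. (k, j)) ` {l\<in>\<rho>. j < l}" by auto
    then show ?thesis unfolding inversions_def above_def by (simp add: card_image inj_on_def)
  qed
  have "a * ext_gen j = (\<Sum>\<rho>\<in>UNIV. ext_smult (ext_coeff a \<rho>) (ext_basis \<rho>)) * ext_basis {j}"
    by (simp add: ext_gen_def flip: ext_expand)
  also have "ext_coeff \<dots> \<sigma> = (\<Sum>\<rho>\<in>UNIV. ext_coeff a \<rho> * ext_coeff (ext_basis_mult \<rho> {j}) \<sigma>)"
    by (simp add: ext_mult_sum ext_mult_smult ext_basis_times_basis)
  also have "\<dots> = (\<Sum>\<rho>\<in>UNIV. if \<rho> = \<sigma> - {j}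
      then (if j \<in> \<sigma> then (- 1) ^ above j \<sigma> * ext_coeff a (\<sigma> - {j}) else 0) else 0)"
  proof (rule sum.cong)
    fix \<rho> :: "'n set"
    \<comment> \<open>Only \<open>\<rho> = \<sigma> - {j}\<close> can yield
      \<open>x_\<sigma>\<close>, so the sum collapses to one term.\<close>
    have "\<rho> \<inter> {j} = {} \<and> \<sigma> = \<rho> \<union> {j} \<longleftrightarrow> \<rho> = \<sigma> - {j} \<and> j \<in> \<sigma>" by auto
    then show "ext_coeff a \<rho> * ext_coeff (ext_basis_mult \<rho> {j}) \<sigma> = (if \<rho> = \<sigma> - {j}
      then (if j \<in> \<sigma> then (- 1) ^ above j \<sigma> * ext_coeff a (\<sigma> - {j}) else 0) else 0)"
      unfolding ext_basis_mult_def
      by (auto simp: ext_coeff_basis inv mult.commute)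
  qed simp
  finally show ?thesis by simp
qed

text \<open>The canonical anticommutation relation. For \<open>i \<noteq> j\<close>, exchanging the
  two operations costs one transposition; for \<open>i = j\<close>, the subtracted term removes from
  \<open>a\<close> exactly the coefficients at sets containing \<open>i\<close>.\<close>

lemma ext_contr_times_gen:
  fixes a :: "('n::{finite, linorder}, 'r::{comm_ring, comm_monoid_mult}) ext"
  shows "ext_contr i (a * ext_gen j) = (if i = j then a else 0) - ext_contr i a * ext_gen j"
proof (rule ext_eqI)
  fix \<sigma> :: "'n set"
  show "ext_coeff (ext_contr i (a * ext_gen j)) \<sigma> =
    ext_coeff ((if i = j then a else 0) - ext_contr i a * ext_gen j) \<sigma>"
  proof (cases "i = j")
    case True
    show ?thesis
    proof (cases "j \<in> \<sigma>")
      case j: True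
      then show ?thesis
        using True by (simp add: ext_contr_def ext_coeff_times_gen neg_one_power_cancel insert_absorb)
    next
      case j: False
      then have "above j (insert j \<sigma>) = above j \<sigma>" "insert j \<sigma> - {j} = \<sigma>"
        by (simp_all add: above_insert)
      with j True show ?thesis
        by (simp add: ext_contr_def ext_coeff_times_gen neg_one_power_cancel)
    qed
  next
    case False
    show ?thesis
    proof (cases "j \<in> \<sigma> \<and> i \<notin> \<sigma>")
      case True
      then obtain \<rho> where \<rho>: "\<sigma> = insert j \<rho>" "j \<notin> \<rho>" by (metis Set.set_insert)
      with True False have i: "i \<notin> \<rho>" and eq: "insert i (insert j \<rho>) - {j} = insert i \<rho>"
        "insert j \<rho> - {j} = \<rho>" by auto
      have ab: "above i (insert j \<rho>) = above i \<rho> + (if i < j then 1 else 0)"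
        "above j (insert i (insert j \<rho>)) = above j \<rho> + (if j < i then 1 else 0)"
        "above j (insert j \<rho>) = above j \<rho>"
        using \<rho>(2) i False by (simp_all add: above_insert)
      \<comment> \<open>Exactly one of the two exponents grows by one, which produces the minus
        sign.\<close>
      from False consider "i < j" "\<not> j < i" | "j < i" "\<not> i < j"
        by (metis less_asym linorder_neqE)
      then show ?thesis
        using \<rho> i False eq ab by cases (simp_all add: ext_contr_def ext_coeff_times_gen neg_one_power)
    next
      case F: False
      with False show ?thesis
        by (auto simp: ext_contr_def ext_coeff_times_gen)
    qed
  qed
qed

text \<open>Scalars are absorbed into the first tensor factor, so sums of pure tensors exhaust the
  algebra and additive identities need checking only on pure tensors.\<close>

lemma env_induct [case_names add tensor]:
  fixes u :: "('n::finite, 'r::{comm_ring, comm_monoid_mult}) env"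
  assumes add: "\<And>u v. P u \<Longrightarrow> P v \<Longrightarrow> P (u + v)" and tensor: "\<And>a b. P (tensor a b)"
  shows "P u"
proof -
  have "P (\<Sum>p\<in>I. env_smult (env_coeff u p) (tensor (ext_basis (fst p)) (ext_basis (snd p))))" for I
  proof (induction I rule: infinite_finite_induct)
    case (insert p I)
    have "P (tensor (ext_smult (env_coeff u p) (ext_basis (fst p))) (ext_basis (snd p)))" by (rule tensor)
    with insert show ?case by (simp add: tensor_bilinear add)
  qed (use tensor[of 0 0] in \<open>simp_all add: tensor_bilinear\<close>)
  then show ?thesis by (subst env_expand)
qed

text \<open>Contracting from the right makes \<open>env_contr\<close> compatible with right multiplication by the
  boundary coefficients, which is how the left-linear boundary acts on coefficients.\<close>

definition env_contr :: "'n \<Rightarrow> ('n, 'r) env \<Rightarrow> ('n::{finite, linorder}, 'r::{comm_ring, comm_monoid_mult}) env"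
  where "env_contr i u = Abs_env (\<lambda>(\<sigma>, \<rho>).
    if i \<in> \<sigma> then 0 else (- 1) ^ above i \<sigma> * env_coeff u (insert i \<sigma>, \<rho>))"

lemma env_coeff_contr:
  "env_coeff (env_contr i u) (\<sigma>, \<rho>) =
    (if i \<in> \<sigma> then 0 else (- 1) ^ above i \<sigma> * env_coeff u (insert i \<sigma>, \<rho>))"
  by (simp add: env_contr_def)

lemma env_contr_tensor: "env_contr i (tensor a b) = tensor (ext_contr i a) b"
  by (rule env_eqI) (auto simp: env_contr_def ext_contr_def case_prod_beta mult.assoc)

lemma env_contr_add: "env_contr i (u + v) = env_contr i u + env_contr i v"
  by (rule env_eqI) (auto simp: env_contr_def case_prod_beta distrib_left)

lemma env_contr_zero [simp]: "env_contr i 0 = 0"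
  by (rule env_eqI) (auto simp: env_contr_def case_prod_beta)

lemma env_contr_uminus: "env_contr i (- u) = - env_contr i u"
  by (rule env_eqI) (auto simp: env_contr_def case_prod_beta)

lemma env_contr_diff: "env_contr i (u - v) = env_contr i u - env_contr i v"
  using env_contr_add[of i u "- v"] by (simp add: env_contr_uminus)

lemma env_contr_sum: "env_contr i (sum f I) = (\<Sum>j\<in>I. env_contr i (f j))"
  by (induction I rule: infinite_finite_induct) (simp_all add: env_contr_add)

text \<open>Each coefficient at a set containing \<open>i\<close> reappears, up to sign, in the
  contraction at that set without \<open>i\<close>.\<close>

lemma env_contr_eq_0_iff:
  "env_contr i u = 0 \<longleftrightarrow> (\<forall>\<sigma> \<rho>. i \<in> \<sigma> \<longrightarrow> env_coeff u (\<sigma>, \<rho>) = 0)"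
proof
  assume eq: "env_contr i u = 0"
  show "\<forall>\<sigma> \<rho>. i \<in> \<sigma> \<longrightarrow> env_coeff u (\<sigma>, \<rho>) = 0"
  proof (intro allI impI)
    fix \<sigma> \<rho> assume i: "i \<in> \<sigma>"
    have "env_coeff (env_contr i u) (\<sigma> - {i}, \<rho>) = 0" by (simp add: eq)
    with i show "env_coeff u (\<sigma>, \<rho>) = 0"
      by (auto simp: env_coeff_contr neg_one_power insert_absorb split: if_splits)
  qed
qed (auto intro!: env_eqI simp: env_contr_def)

lemma env_contr_self [simp]: "env_contr i (env_contr i u) = 0"
  by (simp add: env_contr_eq_0_iff env_coeff_contr)

text \<open>Contraction by \<open>i\<close> creates no \<open>x_j\<close> in the first factor, so a
  reduction already made for \<open>j\<close> survives the treatment of \<open>i\<close>.\<close>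

lemma env_contr_contr_eq_0: "env_contr j u = 0 \<Longrightarrow> env_contr j (env_contr i u) = 0"
  by (simp add: env_contr_eq_0_iff env_coeff_contr)

lemma env_contr_times_left:
  "env_contr i (u * tensor (ext_gen j) 1) = (if i = j then u else 0) - env_contr i u * tensor (ext_gen j) 1"
  by (induction u rule: env_induct)
    (auto simp: distrib_right env_contr_add tensor_times_tensor env_contr_tensor ext_contr_times_gen
      env_eqI algebra_simps)

lemma env_contr_times_right: "env_contr i (u * tensor 1 b) = env_contr i u * tensor 1 b"
  by (induction u rule: env_induct)
    (simp_all add: distrib_right env_contr_add tensor_times_tensor env_contr_tensor)

text \<open>Only coefficients with empty first index survive, and the basis element of the empty set
  is \<open>1\<close>.\<close>

lemma env_eq_tensor_one:
  fixes u :: "('n::{finite, linorder}, 'r::{comm_ring, comm_monoid_mult}) env"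
  assumes "\<And>i. env_contr i u = 0"
  obtains b where "u = tensor 1 b"
proof
  show "u = tensor 1 (Abs_ext (\<lambda>\<rho>. env_coeff u ({}, \<rho>)))"
  proof (rule env_eqI)
    fix p :: "'n set \<times> 'n set"
    show "env_coeff u p = env_coeff (tensor 1 (Abs_ext (\<lambda>\<rho>. env_coeff u ({}, \<rho>)))) p"
      using assms by (cases p) (auto simp: one_ext_def ext_coeff_basis env_contr_eq_0_iff)
  qed
qed


section \<open>The augmentation\<close>

lemma env_act_add_left: "env_act (u + v) a = env_act u a + env_act v a"
  by (simp add: env_act_def ext_smult_simps sum.distrib)

lemma env_act_add_right: "env_act u (a + b) = env_act u a + env_act u b"
  by (simp add: env_act_def ext_smult_simps sum.distrib distrib_left distrib_right)

lemma env_act_times: "env_act (u * v) a = env_act u (env_act v a)"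
proof (induction u rule: env_induct)
  case (tensor c d)
  show ?case
    by (induction v rule: env_induct)
      (simp_all add: distrib_left env_act_add_left env_act_add_right tensor_times_tensor env_act_tensor mult.assoc)
qed (simp add: distrib_right env_act_add_left)

lemma left_module_env_act: "left_module env_act UNIV"
proof
  show "env_act 1 a = a" for a :: "('n::{finite, linorder}, 'r::{comm_ring, comm_monoid_mult}) ext"
    by (simp add: one_env_def env_act_tensor)
qed (simp_all add: env_act_add_left env_act_add_right env_act_times)

text \<open>Acting on \<open>1\<close> is multiplication, as
  \<open>\<alpha> \<otimes> \<beta>\<close> sends \<open>1\<close> to
  \<open>\<alpha> * \<beta>\<close>; \<open>{#}\<close> is the only multiset of size 0.\<close>

definition augm :: "('n multiset \<Rightarrow>\<^sub>0 ('n, 'r) env) \<Rightarrow> ('n::{finite, linorder}, 'r::{comm_ring, comm_monoid_mult}) ext"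
  where "augm p = env_act (Poly_Mapping.lookup p {#}) 1"

lemma augm_add: "augm (p + q) = augm p + augm q"
  by (simp add: augm_def lookup_add env_act_add_left)

lemma augm_hom: "module_hom_on free_smult S env_act UNIV augm"
  by (simp add: module_hom_on_def augm_add) (simp add: augm_def env_act_times)

lemma augm_free_gen: "augm (free_smult (tensor \<alpha> \<beta>) (free_gen {#})) = \<alpha> * \<beta>"
  by (simp add: augm_def free_gen_def env_act_tensor)


section \<open>The boundary and the partial homotopies\<close>

definition bd_coeff :: "nat \<Rightarrow> 'n \<Rightarrow> ('n::{finite, linorder}, 'r::{comm_ring, comm_monoid_mult}) env"
  where "bd_coeff k i = tensor (ext_gen i) 1 + (- 1) ^ k * tensor 1 (ext_gen i)"

text \<open>The sign alternates with the degree, so the mixed terms \<open>x_i \<otimes> x_j\<close>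
  cancel; the remaining ones cancel since generators anticommute.\<close>

lemma bd_coeff_anticommute: "bd_coeff (Suc k) i * bd_coeff k j + bd_coeff (Suc k) j * bd_coeff k i = 0"
  by (cases "even k")
    (simp_all add: bd_coeff_def neg_one_power distrib_left distrib_right tensor_times_tensor algebra_simps
      ext_gen_anticommute[of j i] env_eqI)

lemma bd_coeff_square: "bd_coeff (Suc k) i * bd_coeff k i = 0"
  by (cases "even k")
    (simp_all add: bd_coeff_def neg_one_power algebra_simps tensor_times_tensor ext_gen_square tensor_bilinear)

text \<open>Apart from the term for \<open>i = j\<close>, contraction anticommutes with
  \<open>x_j \<otimes> 1\<close> but commutes with \<open>1 \<otimes> x_j\<close>. Passing from
  \<open>k\<close> to \<open>Suc k\<close> absorbs the difference, matching the degree shift of the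
  homotopy.\<close>

lemma env_contr_times_bd_coeff:
  "env_contr i (u * bd_coeff k j) = (if i = j then u else 0) - env_contr i u * bd_coeff (Suc k) j"
  by (cases "even k")
    (auto simp: bd_coeff_def neg_one_power distrib_left right_diff_distrib env_contr_add env_contr_diff
      env_contr_times_left env_contr_times_right)

text \<open>Organised by target: the coefficient at \<open>\<tau>\<close> collects those at all
  \<open>add_mset i \<tau>\<close>. Left linearity turns the boundary into right multiplication of
  coefficients.\<close>

definition bd :: "nat \<Rightarrow> ('n multiset \<Rightarrow>\<^sub>0 ('n, 'r) env) \<Rightarrow>
    ('n multiset \<Rightarrow>\<^sub>0 ('n::{finite, linorder}, 'r::{comm_ring, comm_monoid_mult}) env)"
  where "bd k p = (\<Sum>i\<in>UNIV. Poly_Mapping.map (\<lambda>u. u * bd_coeff k i) (Poly_Mapping.map_key (add_mset i) p))"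

lemma lookup_bd: "Poly_Mapping.lookup (bd k p) \<tau> = (\<Sum>i\<in>UNIV. Poly_Mapping.lookup p (add_mset i \<tau>) * bd_coeff k i)"
  unfolding bd_def lookup_sum
  by (rule sum.cong) (auto simp: Poly_Mapping.map.rep_eq map_key.rep_eq when_def inj_def)

lemma bd_add: "bd k (p + q) = bd k p + bd k q"
  by (rule poly_mapping_eqI) (simp add: lookup_bd lookup_add distrib_right sum.distrib)

lemma bd_smult: "bd k (free_smult a p) = free_smult a (bd k p)"
  by (rule poly_mapping_eqI) (simp add: lookup_bd sum_distrib_left mult.assoc)

lemma bd_hom:
  assumes "k \<ge> 1"
  shows "module_hom_on free_smult (free_module {\<tau>. size \<tau> = k}) free_smult
    (free_module {\<tau>. size \<tau> = k - 1}) (bd k)"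
proof -
  have "size \<tau> = k - 1" if p: "p \<in> free_module {\<tau>. size \<tau> = k}" and "Poly_Mapping.lookup (bd k p) \<tau> \<noteq> 0"
    for p :: "'a multiset \<Rightarrow>\<^sub>0 ('a, 'b) env" and \<tau>
  proof -
    from that obtain i where "Poly_Mapping.lookup p (add_mset i \<tau>) \<noteq> 0"
      by (metis (no_types, lifting) lookup_bd mult_zero_left sum.neutral)
    with p have "size (add_mset i \<tau>) = k" by (auto simp: free_module_def in_keys_iff)
    then show ?thesis by simp
  qed
  then have "bd k p \<in> free_module {\<tau>. size \<tau> = k - 1}"
    if "p \<in> free_module {\<tau>. size \<tau> = k}" for p :: "'a multiset \<Rightarrow>\<^sub>0 ('a, 'b) env"
    using that unfolding free_module_def[of "{\<tau>. size \<tau> = k - 1}"] by (force simp: in_keys_iff)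
  then show ?thesis
    by (simp add: module_hom_on_def bd_add bd_smult)
qed

lemma bd_bd: "bd k (bd (Suc k) p) = 0"
proof (rule poly_mapping_eqI)
  fix \<tau>
  let ?g = "\<lambda>i j. Poly_Mapping.lookup p (add_mset j (add_mset i \<tau>)) * (bd_coeff (Suc k) j * bd_coeff k i)"
  have "Poly_Mapping.lookup (bd k (bd (Suc k) p)) \<tau> = (\<Sum>i\<in>UNIV. \<Sum>j\<in>UNIV. ?g i j)"
    by (simp add: lookup_bd sum_distrib_right mult.assoc)
  also have "\<dots> = 0"
  proof (rule sum_antisymmetric)
    \<comment> \<open>Exchanging the two removed elements leaves the multiset unchanged, so only the
      boundary coefficients matter.\<close>
    show "?g i j + ?g j i = 0" for i j
      by (simp add: add_mset_commute[of j i] bd_coeff_anticommute flip: distrib_left)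
  qed (simp_all add: bd_coeff_square)
  finally show "Poly_Mapping.lookup (bd k (bd (Suc k) p)) \<tau> = Poly_Mapping.lookup 0 \<tau>" by simp
qed

lemma bd_diff: "bd k (p - q) = bd k p - bd k q"
  by (rule poly_mapping_eqI) (simp add: lookup_bd lookup_minus left_diff_distrib sum_subtractf)

lemma bd_free_gen:
  "bd k (free_gen \<tau>) = (\<Sum>i\<in>set_mset \<tau>. free_smult (bd_coeff k i) (free_gen (\<tau> - {#i#})))"
proof (rule poly_mapping_eqI)
  fix \<rho>
  have eq: "\<tau> = add_mset i \<rho> \<longleftrightarrow> i \<in># \<tau> \<and> \<tau> - {#i#} = \<rho>" for i
    by auto
  have "Poly_Mapping.lookup (bd k (free_gen \<tau>)) \<rho> =
      (\<Sum>i\<in>UNIV. if i \<in># \<tau> then if \<tau> - {#i#} = \<rho> then bd_coeff k i else 0 else 0)"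
    unfolding lookup_bd
    by (rule sum.cong) (simp_all add: free_gen_def lookup_single when_def eq)
  also have "\<dots> = (\<Sum>i\<in>set_mset \<tau>. if \<tau> - {#i#} = \<rho> then bd_coeff k i else 0)"
    by (simp add: sum.If_cases)
  also have "\<dots> = Poly_Mapping.lookup (\<Sum>i\<in>set_mset \<tau>. free_smult (bd_coeff k i) (free_gen (\<tau> - {#i#}))) \<rho>"
    unfolding lookup_sum
    by (rule sum.cong) (simp_all add: free_gen_def lookup_single when_def)
  finally show "Poly_Mapping.lookup (bd k (free_gen \<tau>)) \<rho> = \<dots>" .
qed

lemma augm_bd: "augm (bd 1 p) = 0"
proof -
  have zero: "env_act 0 a = 0" for a :: "('a, 'b) ext"
    using env_act_add_left[of 0 0 a] by simp
  have sum: "env_act (sum f I) a = (\<Sum>i\<in>I. env_act (f i) a)" for f :: "'i \<Rightarrow> ('a, 'b) env" and I a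
    by (induction I rule: infinite_finite_induct) (simp_all add: zero env_act_add_left)
  \<comment> \<open>Both \<open>x_i \<otimes> 1\<close> and \<open>1 \<otimes> x_i\<close> send
    \<open>1\<close> to \<open>x_i\<close>, and in degree 1 they occur with opposite signs.\<close>
  have "env_act (bd_coeff 1 i) 1 = (0 :: ('a, 'b) ext)" for i
    using env_act_add_left[of "tensor (ext_gen i) 1 - tensor 1 (ext_gen i)" "tensor 1 (ext_gen i)" "1 :: ('a, 'b) ext"]
    by (simp add: bd_coeff_def env_act_tensor)
  moreover have "env_act u 0 = (0 :: ('a, 'b) ext)" for u
    using env_act_add_right[of u 0 0] by simp
  ultimately show ?thesis
    by (simp add: augm_def lookup_bd sum env_act_times)
qed

section \<open>The partial homotopies, one for each generator\<close>

definition htpy :: "'n \<Rightarrow> ('n multiset \<Rightarrow>\<^sub>0 ('n, 'r) env) \<Rightarrow>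
    ('n multiset \<Rightarrow>\<^sub>0 ('n::{finite, linorder}, 'r::{comm_ring, comm_monoid_mult}) env)"
  where "htpy i p = Abs_poly_mapping
    (\<lambda>\<tau>. if i \<in># \<tau> then env_contr i (Poly_Mapping.lookup p (\<tau> - {#i#})) else 0)"

text \<open>The support lies in the shift by \<open>i\<close> of the support of \<open>p\<close>,
  hence is finite.\<close>

lemma lookup_htpy:
  "Poly_Mapping.lookup (htpy i p) \<tau> =
    (if i \<in># \<tau> then env_contr i (Poly_Mapping.lookup p (\<tau> - {#i#})) else 0)"
proof -
  have "{\<tau>. (if i \<in># \<tau> then env_contr i (Poly_Mapping.lookup p (\<tau> - {#i#})) else 0) \<noteq> 0}
      \<subseteq> add_mset i ` Poly_Mapping.keys p"
  proof
    fix \<tau> assume "\<tau> \<in> {\<tau>. (if i \<in># \<tau> then env_contr i (Poly_Mapping.lookup p (\<tau> - {#i#})) else 0) \<noteq> 0}"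
    then have "i \<in># \<tau>" "\<tau> - {#i#} \<in> Poly_Mapping.keys p"
      by (auto simp: in_keys_iff split: if_splits)
    then show "\<tau> \<in> add_mset i ` Poly_Mapping.keys p"
      by (metis insert_DiffM imageI)
  qed
  then have "finite {\<tau>. (if i \<in># \<tau> then env_contr i (Poly_Mapping.lookup p (\<tau> - {#i#})) else 0) \<noteq> 0}"
    by (rule finite_subset) simp
  then show ?thesis
    unfolding htpy_def by (subst lookup_Abs_poly_mapping) simp_all
qed

lemma htpy_closed:
  assumes "p \<in> free_module {\<tau>. size \<tau> = k}"
  shows "htpy i p \<in> free_module {\<tau>. size \<tau> = Suc k}"
proof -
  have "size \<tau> = Suc k" if "Poly_Mapping.lookup (htpy i p) \<tau> \<noteq> 0" for \<tau>
  proof -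
    from that have "i \<in># \<tau>" "Poly_Mapping.lookup p (\<tau> - {#i#}) \<noteq> 0"
      by (auto simp: lookup_htpy split: if_splits)
    with assms show ?thesis
      by (auto simp: free_module_def in_keys_iff dest!: multi_member_split)
  qed
  then show ?thesis by (auto simp: free_module_def in_keys_iff)
qed

text \<open>If \<open>i \<in># \<tau>\<close>, the two sums cancel term by term by the contraction
  rule, up to its extra term at \<open>j = i\<close>, which is the coefficient of \<open>p\<close>.
  Otherwise the second summand vanishes and the first keeps only \<open>j = i\<close>.\<close>

lemma bd_htpy:
  "Poly_Mapping.lookup (bd (Suc k) (htpy i p)) \<tau> + Poly_Mapping.lookup (htpy i (bd k p)) \<tau> =
    (if i \<in># \<tau> then Poly_Mapping.lookup p \<tau>
     else env_contr i (Poly_Mapping.lookup p \<tau>) * bd_coeff (Suc k) i)"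
proof -
  let ?c = "\<lambda>j. env_contr i (Poly_Mapping.lookup p (add_mset j \<tau> - {#i#}))"
  have L: "Poly_Mapping.lookup (bd (Suc k) (htpy i p)) \<tau> =
      (\<Sum>j\<in>UNIV. if i \<in># add_mset j \<tau> then ?c j * bd_coeff (Suc k) j else 0)"
    unfolding lookup_bd lookup_htpy by (rule sum.cong) simp_all
  show ?thesis
  proof (cases "i \<in># \<tau>")
    case True
    then have "add_mset j (\<tau> - {#i#}) = add_mset j \<tau> - {#i#}" for j by simp
    with True have "Poly_Mapping.lookup (htpy i (bd k p)) \<tau> =
        (\<Sum>j\<in>UNIV. (if i = j then Poly_Mapping.lookup p \<tau> else 0) - ?c j * bd_coeff (Suc k) j)"
      unfolding lookup_htpy lookup_bd env_contr_sum env_contr_times_bd_coeff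
      by (auto intro!: sum.cong)
    with True L show ?thesis
      by (simp add: sum_subtractf)
  next
    case False
    have "(\<Sum>j\<in>UNIV. if i \<in># add_mset j \<tau> then ?c j * bd_coeff (Suc k) j else 0) =
        (\<Sum>j\<in>UNIV. if j = i then ?c i * bd_coeff (Suc k) i else 0)"
      using False by (intro sum.cong) auto
    with False L show ?thesis
      by (simp add: lookup_htpy)
  qed
qed

section \<open>Reduction of cycles\<close>

text \<open>
  The case \<open>k = 0\<close> is included in the next two lemmas: \<^term>\<open>bd 0\<close> vanishes on
  chains of degree 0, so there every chain counts as a cycle.
\<close>

lemma cycle_reduce:
  assumes "finite S" "p \<in> free_module {\<tau>. size \<tau> = k}" "bd k p = 0"
  shows "\<exists>w\<in>free_module {\<tau>. size \<tau> = Suc k}. \<forall>i\<in>S. \<forall>\<tau>.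
    env_contr i (Poly_Mapping.lookup (p - bd (Suc k) w) \<tau>) = 0 \<and>
    (i \<in># \<tau> \<longrightarrow> Poly_Mapping.lookup (p - bd (Suc k) w) \<tau> = 0)"
  using assms(1)
proof induction
  case empty
  show ?case by (rule bexI[of _ 0]) (simp_all add: free_module_def)
next
  case (insert i S)
  then obtain w where w: "w \<in> free_module {\<tau>. size \<tau> = Suc k}"
    and red: "\<And>j \<tau>. j \<in> S \<Longrightarrow> env_contr j (Poly_Mapping.lookup (p - bd (Suc k) w) \<tau>) = 0"
      "\<And>j \<tau>. j \<in> S \<Longrightarrow> j \<in># \<tau> \<Longrightarrow> Poly_Mapping.lookup (p - bd (Suc k) w) \<tau> = 0"
    by blast
  define q where "q = p - bd (Suc k) w"
  have bq: "bd k q = 0" by (simp add: q_def bd_diff bd_bd assms)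
  interpret M: left_module free_smult "free_module {\<tau>. size \<tau> = k} :: ('a multiset \<Rightarrow>\<^sub>0 ('a, 'b) env) set"
    by (rule left_module_free_module)
  interpret N: left_module free_smult "free_module {\<tau>. size \<tau> = Suc k} :: ('a multiset \<Rightarrow>\<^sub>0 ('a, 'b) env) set"
    by (rule left_module_free_module)
  have "bd (Suc k) w \<in> free_module {\<tau>. size \<tau> = k}"
    using bd_hom[of "Suc k"] w by (auto simp: module_hom_on_def)
  then have "q \<in> free_module {\<tau>. size \<tau> = k}"
    using M.add_closed[OF assms(2) M.uminus_closed] by (simp add: q_def)
  then have mem: "w + htpy i q \<in> free_module {\<tau>. size \<tau> = Suc k}"
    using w by (intro N.add_closed htpy_closed)
  have diff: "p - bd (Suc k) (w + htpy i q) = q - bd (Suc k) (htpy i q)"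
    by (simp add: q_def bd_add)
  \<comment> \<open>Since \<open>q\<close> is a cycle, \<open>bd_htpy\<close> expresses the boundary
    of \<open>htpy i q\<close> alone.\<close>
  have look: "Poly_Mapping.lookup (q - bd (Suc k) (htpy i q)) \<tau> = (if i \<in># \<tau> then 0
      else Poly_Mapping.lookup q \<tau> - env_contr i (Poly_Mapping.lookup q \<tau>) * bd_coeff (Suc k) i)" for \<tau>
    using bd_htpy[of k i q \<tau>] by (cases "i \<in># \<tau>") (simp_all add: bq lookup_htpy lookup_minus)
  \<comment> \<open>For \<open>i\<close>, the contraction rule and \<open>env_contr_self\<close>
    kill the new coefficients; for \<open>j \<in> S\<close>, \<open>env_contr_contr_eq_0\<close>
    preserves the earlier vanishing.\<close>
  show ?case
    using red mem
    by (intro bexI[of _ "w + htpy i q"])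
      (auto simp: diff look env_contr_diff env_contr_times_bd_coeff env_contr_contr_eq_0 simp flip: q_def)
qed

lemma cycle_homologous:
  assumes "p \<in> free_module {\<tau>. size \<tau> = k}" "bd k p = 0"
  obtains w b where "w \<in> free_module {\<tau>. size \<tau> = Suc k}"
    "p - bd (Suc k) w = Poly_Mapping.single {#} (tensor 1 b)"
proof -
  from cycle_reduce[OF finite_class.finite_UNIV assms] obtain w
    where w: "w \<in> free_module {\<tau>. size \<tau> = Suc k}"
      and red: "\<And>j \<tau>. env_contr j (Poly_Mapping.lookup (p - bd (Suc k) w) \<tau>) = 0"
        "\<And>j \<tau>. j \<in># \<tau> \<Longrightarrow> Poly_Mapping.lookup (p - bd (Suc k) w) \<tau> = 0"
    by blast
  obtain b where b: "Poly_Mapping.lookup (p - bd (Suc k) w) {#} = tensor 1 b"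
    using env_eq_tensor_one red(1) by blast
  have "p - bd (Suc k) w = Poly_Mapping.single {#} (tensor 1 b)"
  proof (rule poly_mapping_eqI)
    show "Poly_Mapping.lookup (p - bd (Suc k) w) \<tau> =
      Poly_Mapping.lookup (Poly_Mapping.single {#} (tensor 1 b)) \<tau>" for \<tau>
    proof (cases "\<tau> = {#}")
      case True
      then show ?thesis by (simp only: b lookup_single when_simps simp_thms)
    next
      case False
      then obtain i where "i \<in># \<tau>" by blast
      from red(2)[OF this] False show ?thesis by (simp only: lookup_single when_def if_False) simp
    qed
  qed
  with w show ?thesis by (rule that)
qed

section \<open>Exactness and the augmented resolution\<close>

theorem proposition1:
  shows "\<exists>(b :: nat \<Rightarrow> ('n multiset \<Rightarrow>\<^sub>0 ('n, 'r) env) \<Rightarrow> ('n multiset \<Rightarrow>\<^sub>0 ('n, 'r) env))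
            (eps :: ('n multiset \<Rightarrow>\<^sub>0 ('n, 'r) env)
                      \<Rightarrow> ('n::{finite, linorder}, 'r::{comm_ring, comm_monoid_mult}) ext).
    is_resolution free_smult (\<lambda>k. free_module {\<tau>. size \<tau> = k}) b env_act UNIV eps \<and>
    (\<forall>k\<ge>1. \<forall>\<tau>. size \<tau> = k \<longrightarrow>
      b k (free_gen \<tau>) =
        (\<Sum>i\<in>set_mset \<tau>.
          free_smult (tensor (ext_gen i) 1 + (- 1) ^ k * tensor 1 (ext_gen i)) (free_gen (\<tau> - {#i#})))) \<and>
    (\<forall>\<alpha> \<beta>. eps (free_smult (tensor \<alpha> \<beta>) (free_gen {#})) = \<alpha> * \<beta>)"
proof (intro exI conjI)
  let ?B = "\<lambda>k. free_module {\<tau>. size \<tau> = k} :: ('n multiset \<Rightarrow>\<^sub>0 ('n, 'r) env) set"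
  have closed: "bd (Suc k) w \<in> ?B k" if "w \<in> ?B (Suc k)" for k w
    using bd_hom[of "Suc k"] that by (auto simp: module_hom_on_def)
  have surj: "augm ` ?B 0 = (UNIV :: ('n, 'r) ext set)"
  proof -
    have "a \<in> augm ` ?B 0" for a :: "('n, 'r) ext"
    proof (rule image_eqI)
      show "a = augm (free_smult (tensor 1 a) (free_gen {#}))" by (simp add: augm_free_gen)
      show "free_smult (tensor 1 a) (free_gen {#}) \<in> ?B 0"
        by (auto simp: free_module_def free_gen_def in_keys_iff lookup_single when_def split: if_splits)
    qed
    then show ?thesis by auto
  qed
  have exact0: "bd 1 ` ?B 1 = {p \<in> ?B 0. augm p = (0 :: ('n, 'r) ext)}"
  proof (intro equalityI subsetI)
    fix p assume "p \<in> {p \<in> ?B 0. augm p = (0 :: ('n, 'r) ext)}"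
    then have p: "p \<in> ?B 0" "augm p = 0" by auto
    \<comment> \<open>A chain of degree 0 has no coefficient at a nonempty multiset, so it counts as
      a cycle for \<open>bd 0\<close>.\<close>
    have "Poly_Mapping.lookup p (add_mset i \<tau>) = 0" for i \<tau>
      using p(1) by (auto simp: free_module_def in_keys_iff subset_iff)
    then have "bd 0 p = 0"
      by (intro poly_mapping_eqI) (simp add: lookup_bd)
    then obtain w c where w: "w \<in> ?B (Suc 0)" and eq: "p - bd (Suc 0) w = Poly_Mapping.single {#} (tensor 1 c)"
      using cycle_homologous p(1) by blast
    have "p = bd 1 w + Poly_Mapping.single {#} (tensor 1 c)"
      unfolding eq[symmetric] by simp
    then have "augm p = augm (bd 1 w) + augm (Poly_Mapping.single {#} (tensor 1 c))"
      by (simp add: augm_add)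
    \<comment> \<open>The augmentation kills boundaries and sends the remainder to
      \<open>c\<close>.\<close>
    with p(2) have "c = 0" unfolding augm_bd by (simp add: augm_def env_act_tensor)
    with eq have "p = bd 1 w" by (simp add: tensor_bilinear)
    with w show "p \<in> bd 1 ` ?B 1" by simp
  qed (use closed[of _ 0] in \<open>auto simp: augm_bd[unfolded One_nat_def]\<close>)
  have exact: "bd (k + 1) ` ?B (k + 1) = {p \<in> ?B k. bd k p = 0}" if "k \<ge> 1" for k
  proof (intro equalityI subsetI)
    fix p assume "p \<in> {p \<in> ?B k. bd k p = 0}"
    then have p: "p \<in> ?B k" "bd k p = 0" by auto
    then obtain w c where w: "w \<in> ?B (Suc k)" and eq: "p - bd (Suc k) w = Poly_Mapping.single {#} (tensor 1 c)"
      using cycle_homologous by blast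
    \<comment> \<open>In positive degree the remainder at \<open>{#}\<close> vanishes because
      \<open>{#}\<close> has size 0.\<close>
    have "Poly_Mapping.lookup q {#} = 0" if "q \<in> ?B k" for q
      using that \<open>k \<ge> 1\<close> by (auto simp: free_module_def in_keys_iff subset_iff)
    with p w have "Poly_Mapping.lookup (p - bd (Suc k) w) {#} = 0"
      by (simp add: lookup_minus closed)
    then have "p = bd (k + 1) w" using eq by simp
    with w show "p \<in> bd (k + 1) ` ?B (k + 1)" by simp
  qed (use closed[of _ k] in \<open>auto simp: bd_bd\<close>)
  show "is_resolution free_smult ?B bd env_act UNIV (augm :: _ \<Rightarrow> ('n, 'r) ext)"
    unfolding is_resolution_def
    using left_module_env_act left_module_free_module bd_hom augm_hom surj exact0 exact by blast
qed (simp_all add: bd_free_gen bd_coeff_def augm_free_gen)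

end
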